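(* For every positive integer $k$ there exists a complete simple topological graph on $2^{\lfloor k/2\rfloor}$ vertices that does not contain a topological subgraph weakly isomorphic to $C_{k,k}$.
   Context: A topological graph is a (finite) graph drawn in the plane such that its vertices are represented by points and its edges by non-self-intersecting arcs connecting the corresponding points. No edge passes through a point representing a vertex other than its endpoints. Tangencies between edges are not allowed: if two edges share an interior point, they properly cross at this point. A topological graph is simple if every pair of its edges intersect at most once: at a common endpoint or at a proper crossing. It is complete if its underlying abstract graph is a complete graph. A topological graph $H$ is a topological subgraph of $G$ if $V(H)\subset V(G)$ and $E(H)\subset E(G)$ (with the same drawing). Two topological graphs $G$ and $H$ are weakly isomorphic if there is an incidence preserving bijection between the vertices and edges of $G$ and those of $H$ such that two edges of $G$ cross if and only if the corresponding edges of $H$ cross. $C_{s,t}$ denotes the complete bipartite topological graph with straight-line edges whose $s$ vertices of one class lie on the $y$-axis and whose $t$ vertices of the other class lie on the vertical line $x=1$, with all $st$ straight-line segments between the classes drawn as edges (up to weak isomorphism this does not depend on the exact placement of the vertices on these lines). *)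

theory Defs
  imports "HOL-Analysis.Analysis"
begin

text \<open>
  The plane is \<open>complex\<close>. The abstract graph has points of the plane as vertices and
  two-element sets of vertices as edges; \<open>curve G e\<close> is the point set of the arc that
  represents the edge \<open>e\<close>. Only the values of \<open>curve G\<close> on the edges matter.
\<close>

record topgraph =
  verts :: "complex set"
  edges :: "complex set set"
  curve :: "complex set \<Rightarrow> complex set"

text \<open>
  Near a proper crossing \<open>p\<close> the two curves look, up to a homeomorphism, like the two
  coordinate axes near the origin. For arcs, this says that \<open>p\<close> is an isolated common
  interior point at which each arc passes from one side of the other to the other side.
\<close>

definition properly_cross_at :: "complex set \<Rightarrow> complex set \<Rightarrow> complex \<Rightarrow> bool" where
  "properly_cross_at A B p \<longleftrightarrow>
    (\<exists>U h g. open U \<and> p \<in> U \<and> homeomorphism U (ball 0 1) h g \<and> h p = 0 \<and>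
       h ` (U \<inter> A) = {z \<in> ball 0 1. Im z = 0} \<and>
       h ` (U \<inter> B) = {z \<in> ball 0 1. Re z = 0})"

definition topological_graph :: "topgraph \<Rightarrow> bool" where
  "topological_graph G \<longleftrightarrow>
     finite (verts G) \<and>
     (\<forall>e\<in>edges G. e \<subseteq> verts G \<and> card e = 2) \<and>
     (\<forall>e\<in>edges G. \<exists>\<gamma>. arc \<gamma> \<and> path_image \<gamma> = curve G e \<and>
                       {pathstart \<gamma>, pathfinish \<gamma>} = e) \<and>
     (\<forall>e\<in>edges G. curve G e \<inter> verts G \<subseteq> e) \<and>
     (\<forall>e\<in>edges G. \<forall>f\<in>edges G. e \<noteq> f \<longrightarrow>
        (\<forall>p \<in> (curve G e - e) \<inter> (curve G f - f).
           properly_cross_at (curve G e) (curve G f) p))"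

definition edges_cross :: "topgraph \<Rightarrow> complex set \<Rightarrow> complex set \<Rightarrow> bool" where
  "edges_cross G e f \<longleftrightarrow> (\<exists>p. properly_cross_at (curve G e) (curve G f) p)"

definition simple_topgraph :: "topgraph \<Rightarrow> bool" where
  "simple_topgraph G \<longleftrightarrow>
     (\<forall>e\<in>edges G. \<forall>f\<in>edges G. e \<noteq> f \<longrightarrow>
        curve G e \<inter> curve G f = {} \<or>
        (\<exists>p. curve G e \<inter> curve G f = {p} \<and>
             (p \<in> e \<inter> f \<or> properly_cross_at (curve G e) (curve G f) p)))"

definition complete_topgraph :: "topgraph \<Rightarrow> bool" where
  "complete_topgraph G \<longleftrightarrow> edges G = {e. e \<subseteq> verts G \<and> card e = 2}"

definition topological_subgraph :: "topgraph \<Rightarrow> topgraph \<Rightarrow> bool" where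
  "topological_subgraph H G \<longleftrightarrow>
     topological_graph H \<and> verts H \<subseteq> verts G \<and> edges H \<subseteq> edges G \<and>
     (\<forall>e\<in>edges H. curve H e = curve G e)"

definition weakly_isomorphic :: "topgraph \<Rightarrow> topgraph \<Rightarrow> bool" where
  "weakly_isomorphic G H \<longleftrightarrow>
     (\<exists>\<phi> \<psi>. bij_betw \<phi> (verts G) (verts H) \<and> bij_betw \<psi> (edges G) (edges H) \<and>
        (\<forall>v\<in>verts G. \<forall>e\<in>edges G. v \<in> e \<longleftrightarrow> \<phi> v \<in> \<psi> e) \<and>
        (\<forall>e\<in>edges G. \<forall>f\<in>edges G. e \<noteq> f \<longrightarrow>
           (edges_cross G e f \<longleftrightarrow> edges_cross H (\<psi> e) (\<psi> f))))"

text \<open>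
  \<open>Y\<close> and \<open>Z\<close> are the sets of heights of the vertices on the lines \<open>x = 0\<close> and \<open>x = 1\<close>.
  The convex hull of a two-point set is the straight-line segment between the points.
\<close>

definition straight_bipartite :: "real set \<Rightarrow> real set \<Rightarrow> topgraph" where
  "straight_bipartite Y Z =
     \<lparr> verts = Complex 0 ` Y \<union> Complex 1 ` Z,
       edges = {{Complex 0 y, Complex 1 z} | y z. y \<in> Y \<and> z \<in> Z},
       curve = (\<lambda>e. convex hull e) \<rparr>"

text \<open>
  \<open>C s t\<close> consists of all drawings of \<open>C\<^bsub>s,t\<^esub>\<close>, one for each placement of the vertices on
  the two lines; they are all weakly isomorphic to each other.
\<close>

definition C :: "nat \<Rightarrow> nat \<Rightarrow> topgraph set" where
  "C s t = {straight_bipartite Y Z | Y Z.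
              finite Y \<and> card Y = s \<and> finite Z \<and> card Z = t}"

end

theory Submission
  imports Defs
begin

text \<open>
  Place the vertices on the real line and split the pairs of vertices into two colour classes.
  Draw a pair of the first class as an arch above the line and a pair of the second class as an
  arch below it. Every choice of the classes gives a complete simple topological graph, and
  two edges of different classes can only meet at a common end.

  In a drawing of \<open>C\<^bsub>k,k\<^esub>\<close>, the edge from the lowest vertex on the left to the highest vertex
  on the right crosses all edges that avoid both of these vertices. Vertex-disjoint edges that
  cross have the same class, so a copy of \<open>C\<^bsub>k,k\<^esub>\<close> in the two-page drawing contains a
  monochromatic \<open>K\<^bsub>k-1,k-1\<^esub>\<close> (lemma \<open>bipartite_copy_monochromatic\<close>). On the other hand, a
  random colouring of the pairs of a set of \<open>2 ^ (k div 2)\<close> vertices has no monochromatic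
  \<open>K\<^bsub>k-1,k-1\<^esub>\<close> with positive probability when \<open>k \<ge> 4\<close>: this is the first moment bound of
  Erdos for two-colourings of set systems (lemmas \<open>two_colouring_exists\<close> and
  \<open>colouring_without_monochromatic_bipartite\<close>). For \<open>k < 4\<close> there are fewer than \<open>2 * k\<close>
  vertices, and every drawing works.

  The arch over \<open>[u, v]\<close> is a piece of the parabola \<open>y = (x - u) * (v - x)\<close>. The shear
  \<open>(x, y) \<mapsto> (x, y + x\<^sup>2)\<close> turns all such arches into straight segments; equivalently, the
  difference of two of the quadratic functions is affine. Hence two arches on the same side meet
  at most once, and all crossings that occur, as well as those of straight segments, are covered
  by one lemma on graphs of functions whose difference is affine (\<open>properly_cross_graphs\<close>).
\<close>

section \<open>Proper crossings of function graphs\<close>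

text \<open>
  The two vertical distances \<open>y - g x\<close> and \<open>y - f x\<close> are global coordinates of the plane: their
  difference determines \<open>x\<close>, and then either of them determines \<open>y\<close>. In these coordinates the
  graphs are the axes. Only a neighbourhood of \<open>x0\<close> matters, so the coordinates are
  divided by a small \<open>r\<close>.
\<close>

lemma properly_cross_graphs:
  fixes f g :: "real \<Rightarrow> real"
  assumes f: "continuous_on UNIV f" and g: "continuous_on UNIV g"
    and diff: "\<And>x. g x - f x = m * (x - x0)" and m: "m \<noteq> 0" and d: "d > 0"
    and A: "\<And>z. \<bar>Re z - x0\<bar> < d \<Longrightarrow> z \<in> A \<longleftrightarrow> Im z = f (Re z)"
    and B: "\<And>z. \<bar>Re z - x0\<bar> < d \<Longrightarrow> z \<in> B \<longleftrightarrow> Im z = g (Re z)"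
  shows "properly_cross_at A B (Complex x0 (f x0))"
proof -
  \<comment> \<open>In the scaled coordinates \<open>w = h z\<close>, the abscissa is \<open>x0 + r * (Im w - Re w) / m\<close>. On the unit
    ball, \<open>\<bar>Im w - Re w\<bar> < 2\<close>, so this \<open>r\<close> keeps it at distance less than \<open>d\<close> from \<open>x0\<close>.\<close>
  define r where "r = d * \<bar>m\<bar> / 2"
  have r: "r > 0" using d m by (simp add: r_def)
  define h where "h z = Complex ((Im z - g (Re z)) / r) ((Im z - f (Re z)) / r)" for z
  define X where "X w = x0 + r * (Im w - Re w) / m" for w
  define h' where "h' w = Complex (X w) (r * Im w + f (X w))" for w
  define U where "U = h -` ball 0 1"
  have g_eq: "g x = f x + m * (x - x0)" for x
    using diff[of x] by simp
  have X_h: "X (h z) = Re z" for z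
    using m r by (simp add: X_def h_def g_eq field_simps)
  have inv1: "h' (h z) = z" for z
    using r by (simp add: h'_def X_h) (simp add: h_def complex_eq_iff)
  have mX: "m * (X w - x0) = r * (Im w - Re w)" for w
    using m by (simp add: X_def)
  have inv2: "h (h' w) = w" for w
    using r by (simp add: h'_def h_def complex_eq_iff g_eq mX) (simp add: right_diff_distrib)
  have cont_f: "continuous_on S (\<lambda>z. f (F z))" if "continuous_on S F"
    for S and F :: "complex \<Rightarrow> real"
    by (rule continuous_on_compose2[OF f that]) auto
  have cont_g: "continuous_on S (\<lambda>z. g (F z))" if "continuous_on S F"
    for S and F :: "complex \<Rightarrow> real"
    by (rule continuous_on_compose2[OF g that]) auto
  have cont_h: "continuous_on S h" for S
    unfolding h_def Complex_eq using r
    by (intro continuous_intros cont_f cont_g) auto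
  have cont_h': "continuous_on S h'" for S
    unfolding h'_def X_def Complex_eq using m
    by (intro continuous_intros cont_f) auto
  have near: "\<bar>Re z - x0\<bar> < d" if "z \<in> U" for z
  proof -
    have n: "norm (h z) < 1" using that by (simp add: U_def)
    have "\<bar>Im (h z) - Re (h z)\<bar> < 2"
      using abs_Re_le_cmod[of "h z"] abs_Im_le_cmod[of "h z"] n by linarith
    then have "r * \<bar>Im (h z) - Re (h z)\<bar> / \<bar>m\<bar> < r * 2 / \<bar>m\<bar>"
      using r m by (intro divide_strict_right_mono mult_strict_left_mono) auto
    moreover have "Re z - x0 = r * (Im (h z) - Re (h z)) / m"
      using X_h[of z] unfolding X_def by linarith
    then have "\<bar>Re z - x0\<bar> = r * \<bar>Im (h z) - Re (h z)\<bar> / \<bar>m\<bar>"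
      using r by (simp add: abs_mult)
    ultimately show ?thesis using m by (simp add: r_def)
  qed
  have "open U"
    unfolding U_def using cont_h[of UNIV] by (simp add: open_vimage)
  moreover have p: "h (Complex x0 (f x0)) = 0"
    by (simp add: h_def g_eq complex_eq_iff)
  moreover have "Complex x0 (f x0) \<in> U"
    using p by (simp add: U_def)
  moreover have "homeomorphism U (ball 0 1) h h'"
    by (rule homeomorphismI) (auto simp: cont_h cont_h' U_def inv1 inv2)
  moreover have "h ` (U \<inter> A) = {z \<in> ball 0 1. Im z = 0}"
  proof (intro equalityI subsetI)
    fix w assume "w \<in> h ` (U \<inter> A)"
    then obtain z where z: "z \<in> U" "z \<in> A" "w = h z" by auto
    then have "Im z = f (Re z)" using A near by blast
    then show "w \<in> {z \<in> ball 0 1. Im z = 0}"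
      using z by (simp add: U_def) (simp add: h_def)
  next
    fix w :: complex assume w: "w \<in> {z \<in> ball 0 1. Im z = 0}"
    then have U: "h' w \<in> U" by (simp add: U_def inv2)
    have "h' w \<in> A"
      unfolding A[OF near[OF U]] using w by (simp add: h'_def)
    then show "w \<in> h ` (U \<inter> A)" using U inv2[of w] by (metis IntI imageI)
  qed
  moreover have "h ` (U \<inter> B) = {z \<in> ball 0 1. Re z = 0}"
  proof (intro equalityI subsetI)
    fix w assume "w \<in> h ` (U \<inter> B)"
    then obtain z where z: "z \<in> U" "z \<in> B" "w = h z" by auto
    then have "Im z = g (Re z)" using B near by blast
    then show "w \<in> {z \<in> ball 0 1. Re z = 0}"
      using z by (simp add: U_def) (simp add: h_def)
  next
    fix w :: complex assume w: "w \<in> {z \<in> ball 0 1. Re z = 0}"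
    then have U: "h' w \<in> U" by (simp add: U_def inv2)
    have "h' w \<in> B"
      unfolding B[OF near[OF U]] using w by (simp add: h'_def g_eq mX)
    then show "w \<in> h ` (U \<inter> B)" using U inv2[of w] by (metis IntI imageI)
  qed
  ultimately show ?thesis
    unfolding properly_cross_at_def by blast
qed

lemma properly_cross_at_mem:
  assumes "properly_cross_at A B p"
  shows "p \<in> A" "p \<in> B"
proof -
  obtain U h g where U: "p \<in> U" "homeomorphism U (ball 0 1) h g" "h p = 0"
    "h ` (U \<inter> A) = {z \<in> ball 0 1. Im z = 0}" "h ` (U \<inter> B) = {z \<in> ball 0 1. Re z = 0}"
    using assms unfolding properly_cross_at_def by blast
  have inj: "z = p" if "z \<in> U" "h z = 0" for z
    using U(1,2,3) that by (metis homeomorphism_apply1)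
  have "0 \<in> h ` (U \<inter> A)" "0 \<in> h ` (U \<inter> B)" unfolding U(4,5) by auto
  then show "p \<in> A" "p \<in> B" using inj by fastforce+
qed

section \<open>Straight-line drawings of complete bipartite graphs\<close>

lemma mem_segment_between_lines:
  "w \<in> convex hull {Complex 0 y, Complex 1 z} \<longleftrightarrow>
    0 \<le> Re w \<and> Re w \<le> 1 \<and> Im w = y + (z - y) * Re w"
proof -
  have "w \<in> convex hull {Complex 0 y, Complex 1 z} \<longleftrightarrow>
      (\<exists>t. 0 \<le> t \<and> t \<le> 1 \<and> w = (1 - t) *\<^sub>R Complex 0 y + t *\<^sub>R Complex 1 z)"
    by (auto simp: segment_convex_hull[symmetric] closed_segment_def)
  also have "\<dots> \<longleftrightarrow> 0 \<le> Re w \<and> Re w \<le> 1 \<and> Im w = y + (z - y) * Re w"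
    by (auto simp: complex_eq_iff algebra_simps)
  finally show ?thesis .
qed

lemma straight_bipartite_edges_cross:
  assumes y: "y < y'" and z: "z' < z"
  shows "edges_cross (straight_bipartite Y Z)
    {Complex 0 y, Complex 1 z} {Complex 0 y', Complex 1 z'}"
proof -
  define m where "m = (z' - z) - (y' - y)"
  \<comment> \<open>The segments are \<open>y' - y\<close> apart on the line \<open>x = 0\<close> and \<open>z - z'\<close> apart, in the opposite order,
    on the line \<open>x = 1\<close>.\<close>
  define x0 where "x0 = (y' - y) / ((y' - y) + (z - z'))"
  have m: "m \<noteq> 0" using y z by (simp add: m_def)
  have x0: "0 < x0" "x0 < 1" using y z by (auto simp: x0_def field_simps)
  have mx0: "m * x0 = - (y' - y)"
    using y z by (simp add: m_def x0_def divide_simps) (simp add: algebra_simps)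
  have "properly_cross_at (convex hull {Complex 0 y, Complex 1 z})
      (convex hull {Complex 0 y', Complex 1 z'}) (Complex x0 (y + (z - y) * x0))"
  proof (rule properly_cross_graphs[where d = "min x0 (1 - x0)" and m = m])
    show "continuous_on UNIV (\<lambda>x. y + (z - y) * x)" by (intro continuous_intros)
    show "continuous_on UNIV (\<lambda>x. y' + (z' - y') * x)" by (intro continuous_intros)
    show "y' + (z' - y') * x - (y + (z - y) * x) = m * (x - x0)" for x
      unfolding right_diff_distrib mx0 by (simp add: m_def algebra_simps)
  qed (use m x0 in \<open>auto simp: mem_segment_between_lines\<close>)
  then show ?thesis by (auto simp: edges_cross_def straight_bipartite_def)
qed

text \<open>
  A weak isomorphism maps vertices and edges by two separate bijections. Incidences determine
  the edge map, because an edge of a topological graph is the set of its two ends.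
\<close>

lemma bipartite_copyE:
  assumes H: "topological_graph H"
    and iso: "weakly_isomorphic H (straight_bipartite Y Z)"
  obtains \<alpha> \<beta> where "inj_on \<alpha> Y" "inj_on \<beta> Z" "\<alpha> ` Y \<subseteq> verts H" "\<beta> ` Z \<subseteq> verts H"
    "\<alpha> ` Y \<inter> \<beta> ` Z = {}"
    "\<And>y z. y \<in> Y \<Longrightarrow> z \<in> Z \<Longrightarrow> {\<alpha> y, \<beta> z} \<in> edges H"
    "\<And>y z y' z'. \<lbrakk>y \<in> Y; z \<in> Z; y' \<in> Y; z' \<in> Z; y < y'; z' < z\<rbrakk> \<Longrightarrow>
      edges_cross H {\<alpha> y, \<beta> z} {\<alpha> y', \<beta> z'}"
proof -
  let ?D = "straight_bipartite Y Z"
  obtain \<phi> \<psi> where \<phi>: "bij_betw \<phi> (verts H) (verts ?D)" and \<psi>: "bij_betw \<psi> (edges H) (edges ?D)"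
    and inc: "\<forall>v\<in>verts H. \<forall>e\<in>edges H. v \<in> e \<longleftrightarrow> \<phi> v \<in> \<psi> e"
    and cross: "\<forall>e\<in>edges H. \<forall>f\<in>edges H. e \<noteq> f \<longrightarrow>
      (edges_cross H e f \<longleftrightarrow> edges_cross ?D (\<psi> e) (\<psi> f))"
    using iso unfolding weakly_isomorphic_def by (elim exE conjE) (rule that)
  define q where "q = inv_into (verts H) \<phi>"
  define \<alpha> where "\<alpha> y = q (Complex 0 y)" for y
  define \<beta> where "\<beta> z = q (Complex 1 z)" for z
  have q: "q w \<in> verts H" "\<phi> (q w) = w" if "w \<in> verts ?D" for w
    using that \<phi> unfolding q_def
    by (metis bij_betw_def inv_into_into) (metis \<phi> bij_betw_inv_into_right that)
  have D: "Complex 0 y \<in> verts ?D" if "y \<in> Y" for y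
    using that by (simp add: straight_bipartite_def)
  have D': "Complex 1 z \<in> verts ?D" if "z \<in> Z" for z
    using that by (simp add: straight_bipartite_def)
  have \<alpha>: "\<alpha> y \<in> verts H" "\<phi> (\<alpha> y) = Complex 0 y" if "y \<in> Y" for y
    using q[OF D[OF that]] by (simp_all add: \<alpha>_def)
  have \<beta>: "\<beta> z \<in> verts H" "\<phi> (\<beta> z) = Complex 1 z" if "z \<in> Z" for z
    using q[OF D'[OF that]] by (simp_all add: \<beta>_def)
  have inj_\<alpha>: "inj_on \<alpha> Y"
    by (rule inj_onI) (metis \<alpha>(2) complex.inject)
  have inj_\<beta>: "inj_on \<beta> Z"
    by (rule inj_onI) (metis \<beta>(2) complex.inject)
  have ne: "\<alpha> y \<noteq> \<beta> z" if "y \<in> Y" "z \<in> Z" for y z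
    using \<alpha>(2)[OF that(1)] \<beta>(2)[OF that(2)] by auto
  have edge: "{\<alpha> y, \<beta> z} \<in> edges H \<and> \<psi> {\<alpha> y, \<beta> z} = {Complex 0 y, Complex 1 z}"
    if yz: "y \<in> Y" "z \<in> Z" for y z
  proof -
    have "{Complex 0 y, Complex 1 z} \<in> edges ?D"
      using yz by (auto simp: straight_bipartite_def)
    then obtain e where e: "e \<in> edges H" "\<psi> e = {Complex 0 y, Complex 1 z}"
      using \<psi> unfolding bij_betw_def by (metis imageE)
    have "\<alpha> y \<in> e" "\<beta> z \<in> e"
      using inc \<alpha> \<beta> yz e by auto
    moreover have "card e = 2" using H e(1) by (simp add: topological_graph_def)
    ultimately have "{\<alpha> y, \<beta> z} = e"
      using ne[OF yz] by (intro card_subset_eq) (auto intro: card_ge_0_finite)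
    then show ?thesis using e by simp
  qed
  show thesis
  proof (rule that[of \<alpha> \<beta>])
    fix y z y' z' assume *: "y \<in> Y" "z \<in> Z" "y' \<in> Y" "z' \<in> Z" "y < y'" "z' < z"
    have "\<psi> {\<alpha> y, \<beta> z} \<noteq> \<psi> {\<alpha> y', \<beta> z'}"
      using edge[of y z] edge[of y' z'] * by (simp add: doubleton_eq_iff)
    then have "{\<alpha> y, \<beta> z} \<noteq> {\<alpha> y', \<beta> z'}" by metis
    then show "edges_cross H {\<alpha> y, \<beta> z} {\<alpha> y', \<beta> z'}"
      using edge[of y z] edge[of y' z'] * cross straight_bipartite_edges_cross by simp
  qed (use inj_\<alpha> inj_\<beta> \<alpha> \<beta> ne edge in auto)
qed

section \<open>Two-page drawings with parabolic arches\<close>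

text \<open>
  The product \<open>(x - u) * (v - x)\<close> is symmetric in \<open>u\<close> and \<open>v\<close> and nonnegative exactly when \<open>x\<close>
  lies between them, so the arch over an unordered pair needs no choice of a left end. The factor
  \<open>s\<close> is \<open>1\<close> above and \<open>-1\<close> below the real line.
\<close>

definition arch :: "real \<Rightarrow> complex set \<Rightarrow> complex set" where
  "arch s e = {z. \<exists>u v. e = {u, v} \<and> 0 \<le> (Re z - Re u) * (Re v - Re z) \<and>
                        Im z = s * ((Re z - Re u) * (Re v - Re z))}"

definition page :: "complex set set \<Rightarrow> complex set \<Rightarrow> real" where
  "page S e = (if e \<in> S then 1 else - 1)"

definition two_page :: "complex set \<Rightarrow> complex set set \<Rightarrow> topgraph" where
  "two_page V S =
     \<lparr> verts = V, edges = {e. e \<subseteq> V \<and> card e = 2}, curve = (\<lambda>e. arch (page S e) e) \<rparr>"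

lemma mem_arch:
  "z \<in> arch s {u, v} \<longleftrightarrow>
    0 \<le> (Re z - Re u) * (Re v - Re z) \<and> Im z = s * ((Re z - Re u) * (Re v - Re z))"
proof -
  have "(Re z - Re v) * (Re u - Re z) = (Re z - Re u) * (Re v - Re z)"
    by (simp add: algebra_simps)
  then show ?thesis
    unfolding arch_def by (auto simp: doubleton_eq_iff)
qed

lemma two_page_edgeE:
  assumes "V \<subseteq> \<real>" "e \<in> edges (two_page V S)"
  obtains u v where "e = {complex_of_real u, complex_of_real v}" "u \<noteq> v"
proof -
  have e: "e \<subseteq> V" "card e = 2" using assms(2) by (simp_all add: two_page_def)
  then obtain a b where ab: "e = {a, b}" "a \<noteq> b" by (auto simp: card_2_iff)
  then have "a \<in> \<real>" "b \<in> \<real>" using e assms(1) by auto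
  then obtain u v where "a = of_real u" "b = of_real v" by (auto elim!: Reals_cases)
  with ab that show thesis by auto
qed

lemma arch_meets_real_line:
  assumes e: "e = {complex_of_real u, complex_of_real v}" and s: "s \<noteq> 0" and z: "z \<in> arch s e"
  shows "z \<in> e \<longleftrightarrow> Im z = 0"
  using z s unfolding e mem_arch by (auto simp: complex_eq_iff)

lemma arch_is_arc:
  assumes e: "e = {complex_of_real u, complex_of_real v}" and uv: "u \<noteq> v"
  shows "\<exists>\<gamma>. arc \<gamma> \<and> path_image \<gamma> = arch s e \<and> {pathstart \<gamma>, pathfinish \<gamma>} = e"
proof -
  define \<gamma> where "\<gamma> t = Complex (u + t * (v - u)) (s * ((v - u)\<^sup>2 * (t * (1 - t))))" for t
  have "path \<gamma>"
    unfolding path_def \<gamma>_def Complex_eq by (intro continuous_intros)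
  moreover have "inj_on \<gamma> {0..1}"
    using uv by (auto simp: inj_on_def \<gamma>_def)
  moreover have "path_image \<gamma> = arch s e"
  proof (intro equalityI subsetI)
    fix z assume "z \<in> path_image \<gamma>"
    then obtain t where t: "0 \<le> t" "t \<le> 1" "z = \<gamma> t" by (auto simp: path_image_def)
    have *: "(Re z - u) * (v - Re z) = (v - u)\<^sup>2 * (t * (1 - t))"
      unfolding t(3) \<gamma>_def by (simp add: power2_eq_square algebra_simps)
    have "Im z = s * ((Re z - u) * (v - Re z))"
      unfolding * using t(3) by (simp add: \<gamma>_def)
    moreover have "0 \<le> (Re z - u) * (v - Re z)"
      unfolding * using t by simp
    ultimately show "z \<in> arch s e"
      unfolding e mem_arch by simp
  next
    fix z assume "z \<in> arch s e"
    then have z: "0 \<le> (Re z - u) * (v - Re z)" "Im z = s * ((Re z - u) * (v - Re z))"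
      unfolding e mem_arch by simp_all
    define t where "t = (Re z - u) / (v - u)"
    have x: "Re z = u + t * (v - u)" using uv by (simp add: t_def)
    have *: "(Re z - u) * (v - Re z) = (v - u)\<^sup>2 * (t * (1 - t))"
      unfolding x by (simp add: power2_eq_square algebra_simps)
    have "0 \<le> t * (1 - t)" using z(1) uv unfolding * by (simp add: zero_le_mult_iff)
    then have "t \<in> {0..1}" by (auto simp: zero_le_mult_iff)
    moreover have "z = \<gamma> t" using x z(2) * by (simp add: \<gamma>_def complex_eq_iff)
    ultimately show "z \<in> path_image \<gamma>" by (auto simp: path_image_def)
  qed
  moreover have "{pathstart \<gamma>, pathfinish \<gamma>} = e"
    by (simp add: e pathstart_def pathfinish_def \<gamma>_def complex_of_real_def)
  ultimately show ?thesis unfolding arc_def by blast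
qed

lemma sum_product_determine_pair:
  fixes u v u' v' :: real
  assumes s: "u + v = u' + v'" and p: "u * v = u' * v'"
  shows "{u, v} = {u', v'}"
proof -
  have v: "v = u' + v' - u" using s by simp
  have "(u - u') * (u - v') = 0" using p unfolding v by (simp add: algebra_simps)
  then show ?thesis using v by auto
qed

text \<open>
  A common point off the real line determines the page of both arches, since they lie on the
  same side there.
\<close>

lemma arches_off_line:
  assumes z: "z \<in> arch s {u, v}" "z \<in> arch s' {u', v'}" "Im z \<noteq> 0"
    and s: "s \<in> {1, - 1}" "s' \<in> {1, - 1}"
  shows "s = s'" "0 < (Re z - Re u) * (Re v - Re z)" "0 < (Re z - Re u') * (Re v' - Re z)"
proof -
  define P where "P = (Re z - Re u) * (Re v - Re z)"
  define Q where "Q = (Re z - Re u') * (Re v' - Re z)"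
  have "0 \<le> P" "Im z = s * P" "0 \<le> Q" "Im z = s' * Q"
    using z(1,2) by (simp_all add: mem_arch P_def Q_def)
  then show "s = s'" "0 < P" "0 < Q"
    using z(3) s by auto
qed

text \<open>
  Two different arches on the same side are graphs whose difference is affine and not constant
  once it vanishes somewhere: a constant difference would then be zero, and the sum and the
  product of the ends would agree.
\<close>

lemma arches_difference:
  fixes u v u' v' x0 :: real
  assumes x0: "(x0 - u) * (v - x0) = (x0 - u') * (v' - x0)"
    and ne: "{u, v} \<noteq> {u', v'}"
  shows "(x - u') * (v' - x) - (x - u) * (v - x) = (u' + v' - (u + v)) * (x - x0)"
    and "u' + v' - (u + v) \<noteq> 0"
proof -
  show "(x - u') * (v' - x) - (x - u) * (v - x) = (u' + v' - (u + v)) * (x - x0)"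
    using x0 by (simp add: algebra_simps)
  show "u' + v' - (u + v) \<noteq> 0"
  proof
    assume 0: "u' + v' - (u + v) = 0"
    then have v': "v' = u + v - u'" by simp
    have "u * v = u' * v'" using x0 unfolding v' by (simp add: algebra_simps)
    then show False using sum_product_determine_pair[of u v u' v'] 0 ne by simp
  qed
qed

lemma arches_cross:
  assumes e: "e = {complex_of_real u, complex_of_real v}"
    and f: "f = {complex_of_real u', complex_of_real v'}"
    and ef: "e \<noteq> f" and s: "s \<in> {1, - 1}" "s' \<in> {1, - 1}"
    and p: "p \<in> arch s e" "p \<in> arch s' f" "Im p \<noteq> 0"
  shows "properly_cross_at (arch s e) (arch s' f) p"
proof -
  define F where "F x = (x - u) * (v - x)" for x
  define G where "G x = (x - u') * (v' - x)" for x
  have ss: "s' = s" and pos: "0 < F (Re p)" "0 < G (Re p)"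
    using arches_off_line[OF p(1,2)[unfolded e f] p(3) s] by (simp_all add: F_def G_def)
  have s0: "s \<noteq> 0" using s by auto
  have Im: "Im p = s * F (Re p)" "Im p = s * G (Re p)"
    using p(1,2) unfolding e f ss mem_arch by (simp_all add: F_def G_def)
  have FG: "F (Re p) = G (Re p)" using Im s0 by simp
  have ne: "{u, v} \<noteq> {u', v'}" using ef unfolding e f by (auto simp: doubleton_eq_iff)
  note diff = arches_difference[OF FG[unfolded F_def G_def] ne]
  have "open {x. 0 < F x \<and> 0 < G x}"
    unfolding F_def G_def
    by (intro open_Collect_conj open_Collect_less continuous_intros)
  then obtain d where d: "d > 0" "\<And>x. dist x (Re p) < d \<Longrightarrow> 0 < F x \<and> 0 < G x"
    unfolding open_dist using pos by blast
  have "properly_cross_at (arch s e) (arch s' f) (Complex (Re p) (s * F (Re p)))"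
  proof (rule properly_cross_graphs[where d = d and m = "s * (u' + v' - (u + v))"])
    show "continuous_on UNIV (\<lambda>x. s * F x)"
      unfolding F_def by (intro continuous_intros)
    show "continuous_on UNIV (\<lambda>x. s * G x)"
      unfolding G_def by (intro continuous_intros)
    show "s * G x - s * F x = s * (u' + v' - (u + v)) * (x - Re p)" for x
      using diff(1)[of x] unfolding F_def G_def by (simp flip: right_diff_distrib add: mult.assoc)
    show "s * (u' + v' - (u + v)) \<noteq> 0" using diff(2) s0 by simp
    show "d > 0" by (rule d(1))
    fix z assume "\<bar>Re z - Re p\<bar> < d"
    then have "0 < F (Re z)" "0 < G (Re z)" using d(2)[of "Re z"] by (simp_all add: dist_real_def)
    then show "z \<in> arch s e \<longleftrightarrow> Im z = s * F (Re z)" "z \<in> arch s' f \<longleftrightarrow> Im z = s * G (Re z)"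
      unfolding e f ss mem_arch by (simp_all add: F_def G_def)
  qed
  then show ?thesis using Im(1) by (metis complex_surj)
qed

text \<open>
  Off the real line, the affine difference of the two arches vanishes only once; on the line, the
  common points are common ends, and two different pairs share at most one of them.
\<close>

lemma arches_meet_once:
  assumes e: "e = {complex_of_real u, complex_of_real v}"
    and f: "f = {complex_of_real u', complex_of_real v'}"
    and ef: "e \<noteq> f" and s: "s \<in> {1, - 1}" "s' \<in> {1, - 1}"
    and p: "p \<in> arch s e" "p \<in> arch s' f" and q: "q \<in> arch s e" "q \<in> arch s' f"
  shows "p = q"
proof -
  have ne: "{u, v} \<noteq> {u', v'}" using ef unfolding e f by (auto simp: doubleton_eq_iff)
  have off: "a = b" if a: "a \<in> arch s e" "a \<in> arch s' f" "Im a \<noteq> 0"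
    and b: "b \<in> arch s e" "b \<in> arch s' f" for a b
  proof -
    have ss: "s' = s" using arches_off_line(1)[OF a(1,2)[unfolded e f] a(3) s] by simp
    have s0: "s \<noteq> 0" using s by auto
    have Im: "Im z = s * ((Re z - u) * (v - Re z))"
      "(Re z - u) * (v - Re z) = (Re z - u') * (v' - Re z)"
      if "z \<in> arch s e" "z \<in> arch s' f" for z
      using that s0 unfolding e f ss mem_arch by simp_all
    have "Re b = Re a"
      using arches_difference(1)[OF Im(2)[OF a(1,2)] ne, of "Re b"]
        arches_difference(2)[OF Im(2)[OF a(1,2)] ne] Im(2)[OF b] by simp
    then show ?thesis using Im(1)[OF a(1,2)] Im(1)[OF b] by (simp add: complex_eq_iff)
  qed
  show ?thesis
  proof (cases "Im p = 0 \<and> Im q = 0")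
    case True
    have s0: "s \<noteq> 0" "s' \<noteq> 0" using s by auto
    have "p \<in> e" "q \<in> e"
      using True arch_meets_real_line[OF e s0(1)] p(1) q(1) by simp_all
    moreover have "p \<in> f" "q \<in> f"
      using True arch_meets_real_line[OF f s0(2)] p(2) q(2) by simp_all
    moreover have "a = {p, q}" if "p \<noteq> q" "p \<in> a" "q \<in> a" "a = {x, y}" for a x y
      using that by auto
    ultimately show ?thesis using ef e f by metis
  next
    case False
    then consider "Im p \<noteq> 0" | "Im q \<noteq> 0" by blast
    then show ?thesis
    proof cases
      case 1
      then show ?thesis by (rule off[OF p _ q])
    next
      case 2
      then show ?thesis by (rule off[OF q _ p, symmetric])
    qed
  qed
qed

lemma page_cases: "page S e \<in> {1, - 1}"
  by (simp add: page_def)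

lemma page_nonzero: "page S e \<noteq> 0"
  by (simp add: page_def)

lemma topological_graph_two_page:
  assumes "finite V" "V \<subseteq> \<real>"
  shows "topological_graph (two_page V S)"
  unfolding topological_graph_def
proof (intro conjI ballI impI)
  show "finite (verts (two_page V S))" using assms by (simp add: two_page_def)
next
  fix e assume E: "e \<in> edges (two_page V S)"
  then have sub: "e \<subseteq> V" "card e = 2" by (simp_all add: two_page_def)
  show "e \<subseteq> verts (two_page V S)" "card e = 2" using sub by (simp_all add: two_page_def)
  obtain u v where e: "e = {complex_of_real u, complex_of_real v}" "u \<noteq> v"
    using two_page_edgeE[OF assms(2) E] .
  show "\<exists>\<gamma>. arc \<gamma> \<and> path_image \<gamma> = curve (two_page V S) e \<and> {pathstart \<gamma>, pathfinish \<gamma>} = e"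
    using arch_is_arc[OF e] by (simp add: two_page_def)
  show "curve (two_page V S) e \<inter> verts (two_page V S) \<subseteq> e"
  proof
    fix z assume z: "z \<in> curve (two_page V S) e \<inter> verts (two_page V S)"
    then have "Im z = 0" using assms(2) by (auto simp: two_page_def complex_is_Real_iff)
    then show "z \<in> e"
      using arch_meets_real_line[OF e(1) page_nonzero] z by (auto simp: two_page_def)
  qed
next
  fix e f p assume *: "e \<in> edges (two_page V S)" "f \<in> edges (two_page V S)" "e \<noteq> f"
    "p \<in> (curve (two_page V S) e - e) \<inter> (curve (two_page V S) f - f)"
  obtain u v where e: "e = {complex_of_real u, complex_of_real v}" and "u \<noteq> v"
    using two_page_edgeE[OF assms(2) *(1)] .
  obtain u' v' where f: "f = {complex_of_real u', complex_of_real v'}" and "u' \<noteq> v'"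
    using two_page_edgeE[OF assms(2) *(2)] .
  have p: "p \<in> arch (page S e) e" "p \<in> arch (page S f) f" "p \<notin> e"
    using * by (simp_all add: two_page_def)
  have "Im p \<noteq> 0" using p arch_meets_real_line[OF e page_nonzero] by blast
  then show "properly_cross_at (curve (two_page V S) e) (curve (two_page V S) f) p"
    using arches_cross[OF e f *(3) page_cases page_cases p(1,2)] by (simp add: two_page_def)
qed

lemma simple_topgraph_two_page:
  assumes "V \<subseteq> \<real>"
  shows "simple_topgraph (two_page V S)"
  unfolding simple_topgraph_def
proof (intro ballI impI)
  fix e f assume *: "e \<in> edges (two_page V S)" "f \<in> edges (two_page V S)" "e \<noteq> f"
  let ?e = "curve (two_page V S) e" and ?f = "curve (two_page V S) f"
  have c: "?e = arch (page S e) e" "?f = arch (page S f) f" by (simp_all add: two_page_def)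
  obtain u v where e: "e = {complex_of_real u, complex_of_real v}" and "u \<noteq> v"
    using two_page_edgeE[OF assms *(1)] .
  obtain u' v' where f: "f = {complex_of_real u', complex_of_real v'}" and "u' \<noteq> v'"
    using two_page_edgeE[OF assms *(2)] .
  show "?e \<inter> ?f = {} \<or> (\<exists>p. ?e \<inter> ?f = {p} \<and> (p \<in> e \<inter> f \<or> properly_cross_at ?e ?f p))"
  proof (cases "?e \<inter> ?f = {}")
    case False
    then obtain p where p: "p \<in> arch (page S e) e" "p \<in> arch (page S f) f" unfolding c by auto
    have "?e \<inter> ?f = {p}"
      unfolding c using arches_meet_once[OF e f *(3) page_cases page_cases p] p by blast
    moreover have "p \<in> e \<inter> f \<or> properly_cross_at ?e ?f p"
    proof (cases "Im p = 0")
      case True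
      then show ?thesis
        using arch_meets_real_line[OF e page_nonzero p(1)]
          arch_meets_real_line[OF f page_nonzero p(2)] by simp
    next
      case False
      then show ?thesis
        using arches_cross[OF e f *(3) page_cases page_cases p] unfolding c by simp
    qed
    ultimately show ?thesis by blast
  qed simp
qed

lemma complete_topgraph_two_page: "complete_topgraph (two_page V S)"
  by (simp add: complete_topgraph_def two_page_def)

text \<open>
  A common point of two arches on the real line is a common end. Disjoint edges can therefore only
  cross off the line, and there both arches lie on the same side.
\<close>

lemma crossing_edges_same_page:
  assumes V: "V \<subseteq> \<real>" and e: "e \<in> edges (two_page V S)" and f: "f \<in> edges (two_page V S)"
    and disj: "e \<inter> f = {}" and cross: "edges_cross (two_page V S) e f"
  shows "e \<in> S \<longleftrightarrow> f \<in> S"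
proof -
  obtain p where "properly_cross_at (arch (page S e) e) (arch (page S f) f) p"
    using cross by (auto simp: edges_cross_def two_page_def)
  then have p: "p \<in> arch (page S e) e" "p \<in> arch (page S f) f"
    by (rule properly_cross_at_mem)+
  obtain u v where e': "e = {complex_of_real u, complex_of_real v}" and "u \<noteq> v"
    using two_page_edgeE[OF V e] .
  obtain u' v' where f': "f = {complex_of_real u', complex_of_real v'}" and "u' \<noteq> v'"
    using two_page_edgeE[OF V f] .
  have "Im p \<noteq> 0"
    using arch_meets_real_line[OF e' page_nonzero p(1)]
      arch_meets_real_line[OF f' page_nonzero p(2)] disj by auto
  then have "page S e = page S f"
    unfolding e' f' by (rule arches_off_line(1)[OF p[unfolded e' f'] _ page_cases page_cases])
  then show ?thesis by (simp add: page_def split: if_splits)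
qed

section \<open>Copies of \<open>C\<^bsub>k,k\<^esub>\<close> are almost monochromatic\<close>

definition biclique :: "'a set \<Rightarrow> 'a set \<Rightarrow> 'a set set" where
  "biclique A B = (\<lambda>(a, b). {a, b}) ` (A \<times> B)"

text \<open>
  The edge that joins the lowest left vertex to the highest right vertex crosses each edge
  that avoids both of them, so all of these have its colour.
\<close>

lemma bipartite_copy_monochromatic:
  assumes V: "V \<subseteq> \<real>" and k: "k > 0"
    and sub: "topological_subgraph H (two_page V S)"
    and D: "D \<in> C k k" and iso: "weakly_isomorphic H D"
  shows "\<exists>A B. A \<subseteq> V \<and> B \<subseteq> V \<and> A \<inter> B = {} \<and> card A = k - 1 \<and> card B = k - 1 \<and>
    (biclique A B \<subseteq> S \<or> biclique A B \<inter> S = {})"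
proof -
  let ?G = "two_page V S"
  obtain Y Z where YZ: "finite Y" "card Y = k" "finite Z" "card Z = k"
    and DYZ: "D = straight_bipartite Y Z"
    using D unfolding C_def by blast
  have H: "topological_graph H" using sub by (simp add: topological_subgraph_def)
  obtain \<alpha> \<beta> where inj: "inj_on \<alpha> Y" "inj_on \<beta> Z"
    and vs: "\<alpha> ` Y \<subseteq> verts H" "\<beta> ` Z \<subseteq> verts H" "\<alpha> ` Y \<inter> \<beta> ` Z = {}"
    and edge: "\<And>y z. y \<in> Y \<Longrightarrow> z \<in> Z \<Longrightarrow> {\<alpha> y, \<beta> z} \<in> edges H"
    and cross: "\<And>y z y' z'. \<lbrakk>y \<in> Y; z \<in> Z; y' \<in> Y; z' \<in> Z; y < y'; z' < z\<rbrakk> \<Longrightarrow>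
      edges_cross H {\<alpha> y, \<beta> z} {\<alpha> y', \<beta> z'}"
    using bipartite_copyE[OF H iso[unfolded DYZ]] by blast
  have VV: "verts H \<subseteq> V" using sub by (simp add: topological_subgraph_def two_page_def)
  have edge_G: "{\<alpha> y, \<beta> z} \<in> edges ?G" if "y \<in> Y" "z \<in> Z" for y z
    using edge[OF that] sub by (auto simp: topological_subgraph_def)
  have cross_G: "edges_cross ?G {\<alpha> y, \<beta> z} {\<alpha> y', \<beta> z'}"
    if "y \<in> Y" "z \<in> Z" "y' \<in> Y" "z' \<in> Z" "y < y'" "z' < z" for y z y' z'
    using cross[OF that] edge that sub by (simp add: topological_subgraph_def edges_cross_def)
  define y0 where "y0 = Min Y"
  define z0 where "z0 = Max Z"
  have "Y \<noteq> {}" "Z \<noteq> {}" using YZ k by auto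
  then have y0: "y0 \<in> Y" "\<And>y. y \<in> Y - {y0} \<Longrightarrow> y0 < y"
    and z0: "z0 \<in> Z" "\<And>z. z \<in> Z - {z0} \<Longrightarrow> z < z0"
    using YZ by (auto simp: y0_def z0_def order_less_le)
  let ?A = "\<alpha> ` (Y - {y0})" and ?B = "\<beta> ` (Z - {z0})"
  have same: "{\<alpha> y, \<beta> z} \<in> S \<longleftrightarrow> {\<alpha> y0, \<beta> z0} \<in> S"
    if yz: "y \<in> Y - {y0}" "z \<in> Z - {z0}" for y z
  proof -
    have "\<alpha> y \<noteq> \<alpha> y0" "\<beta> z \<noteq> \<beta> z0"
      using yz y0(1) z0(1) inj by (auto simp: inj_on_eq_iff)
    moreover have "\<alpha> y0 \<noteq> \<beta> z" "\<alpha> y \<noteq> \<beta> z0"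
      using yz y0(1) z0(1) vs(3) by auto
    ultimately have "{\<alpha> y0, \<beta> z0} \<inter> {\<alpha> y, \<beta> z} = {}" by auto
    then show ?thesis
      using crossing_edges_same_page[OF V edge_G edge_G _ cross_G] yz y0 z0 by blast
  qed
  have "biclique ?A ?B \<subseteq> S \<or> biclique ?A ?B \<inter> S = {}"
    unfolding biclique_def using same by (cases "{\<alpha> y0, \<beta> z0} \<in> S") auto
  moreover have "card ?A = k - 1" "card ?B = k - 1"
    using YZ y0(1) z0(1) inj
    by (auto simp: card_image inj_on_diff)
  moreover have "?A \<subseteq> V" "?B \<subseteq> V" "?A \<inter> ?B = {}" using vs VV by auto
  ultimately show ?thesis by (intro exI[of _ ?A] exI[of _ ?B] conjI)
qed

lemma verts_of_bipartite_copy: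
  assumes fin: "finite (verts G)" and sub: "topological_subgraph H G"
    and D: "D \<in> C k k" and iso: "weakly_isomorphic H D"
  shows "2 * k \<le> card (verts G)"
proof -
  obtain Y Z where YZ: "finite Y" "card Y = k" "finite Z" "card Z = k"
    and DYZ: "D = straight_bipartite Y Z"
    using D unfolding C_def by blast
  have "card (verts H) = card (verts D)"
    using iso by (auto simp: weakly_isomorphic_def intro: bij_betw_same_card)
  also have "\<dots> = card (Complex 0 ` Y \<union> Complex 1 ` Z)"
    by (simp add: DYZ straight_bipartite_def)
  also have "\<dots> = card (Complex 0 ` Y) + card (Complex 1 ` Z)"
    using YZ by (intro card_Un_disjoint) auto
  also have "\<dots> = 2 * k"
    using YZ by (simp add: card_image inj_on_def)
  finally show ?thesis
    using card_mono[OF fin, of "verts H"] sub by (simp add: topological_subgraph_def)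
qed

section \<open>Colourings without monochromatic bicliques\<close>

text \<open>
  Colour the points of \<open>E\<close> independently and uniformly. A fixed set of \<open>d\<close> points is
  monochromatic with probability \<open>2 / 2 ^ d\<close>, so some colouring leaves no member of \<open>\<F>\<close>
  monochromatic as soon as \<open>\<F>\<close> has fewer than \<open>2 ^ d / 2\<close> members.
\<close>

lemma two_colouring_exists:
  assumes E: "finite E" and \<F>: "\<F> \<subseteq> Pow E" "\<And>F. F \<in> \<F> \<Longrightarrow> card F = d"
    and small: "2 * card \<F> < 2 ^ d"
  shows "\<exists>S\<subseteq>E. \<forall>F\<in>\<F>. \<not> F \<subseteq> S \<and> F \<inter> S \<noteq> {}"
proof (cases "\<F> = {}")
  case False
  define bad where "bad F = {S \<in> Pow E. F \<subseteq> S} \<union> {S \<in> Pow E. F \<inter> S = {}}" for F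
  have fin: "finite \<F>" using \<F>(1) E by (meson finite_Pow_iff finite_subset)
  have dE: "d \<le> card E" using False \<F> E by (metis PowD card_mono ex_in_conv subsetD)
  have card_bad: "card (bad F) \<le> 2 * 2 ^ (card E - d)" if "F \<in> \<F>" for F
  proof -
    have F: "F \<subseteq> E" "card F = d" using that \<F> by auto
    have "finite F" using F(1) E by (rule finite_subset)
    note F = F this
    have c: "card (Pow (E - F)) = 2 ^ (card E - d)"
      using F E by (simp add: card_Pow card_Diff_subset)
    have "{S \<in> Pow E. F \<subseteq> S} \<subseteq> (\<lambda>T. F \<union> T) ` Pow (E - F)"
    proof
      fix S assume "S \<in> {S \<in> Pow E. F \<subseteq> S}"
      then have "S = F \<union> (S - F)" "S - F \<in> Pow (E - F)" by auto
      then show "S \<in> (\<lambda>T. F \<union> T) ` Pow (E - F)" by blast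
    qed
    then have "card {S \<in> Pow E. F \<subseteq> S} \<le> 2 ^ (card E - d)"
      using surj_card_le[of "Pow (E - F)"] E c by auto
    moreover have "{S \<in> Pow E. F \<inter> S = {}} = Pow (E - F)" by auto
    ultimately show ?thesis
      unfolding bad_def using c card_Un_le[of "{S \<in> Pow E. F \<subseteq> S}" "{S \<in> Pow E. F \<inter> S = {}}"]
      by simp
  qed
  have "card (\<Union>F\<in>\<F>. bad F) \<le> (\<Sum>F\<in>\<F>. card (bad F))"
    using fin by (rule card_UN_le)
  also have "\<dots> \<le> card \<F> * (2 * 2 ^ (card E - d))"
    using sum_bounded_above[of \<F> "\<lambda>F. card (bad F)"] card_bad by simp
  also have "\<dots> = 2 * card \<F> * 2 ^ (card E - d)" by simp
  also have "\<dots> < 2 ^ d * 2 ^ (card E - d)" using small by simp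
  also have "\<dots> = card (Pow E)" using dE E by (simp add: card_Pow flip: power_add)
  finally have "(\<Union>F\<in>\<F>. bad F) \<noteq> Pow E" by (metis less_irrefl)
  moreover have "(\<Union>F\<in>\<F>. bad F) \<subseteq> Pow E" by (auto simp: bad_def)
  ultimately obtain S where "S \<in> Pow E" "S \<notin> (\<Union>F\<in>\<F>. bad F)" by blast
  then show ?thesis by (auto simp: bad_def)
qed auto

lemma card_biclique:
  assumes "A \<inter> B = {}"
  shows "card (biclique A B) = card A * card B"
proof -
  have "inj_on (\<lambda>(a, b). {a, b}) (A \<times> B)"
    using assms by (auto simp: inj_on_def doubleton_eq_iff)
  then show ?thesis by (simp add: biclique_def card_image card_cartesian_product)
qed

lemma power2_lt_fact_squared:
  assumes "3 \<le> m"
  shows "2 ^ (m + 1) < (fact m :: nat)\<^sup>2"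
  using assms
proof (induction m rule: nat_induct_at_least)
  case base
  show ?case by (simp add: fact_numeral)
next
  case (Suc m)
  have "(2::nat) ^ (Suc m + 1) = 2 * 2 ^ (m + 1)" by simp
  also have "\<dots> < 2 * (fact m)\<^sup>2" using Suc.IH by simp
  also have "\<dots> \<le> (Suc m)\<^sup>2 * (fact m)\<^sup>2"
    using Suc.hyps by (intro mult_right_mono) (auto simp: power2_eq_square)
  also have "\<dots> = (fact (Suc m))\<^sup>2" by (simp only: fact_Suc of_nat_id power_mult_distrib)
  finally show ?case .
qed

text \<open>
  There are at most \<open>(n choose m)\<^sup>2\<close> bicliques with \<open>m\<close> vertices in each class on \<open>n\<close>
  vertices, and \<open>n choose m \<le> n ^ m / fact m\<close> gives
  \<open>(n choose m)\<^sup>2 \<le> 2 ^ ((m + 1) * m) / (fact m)\<^sup>2\<close>. The factor \<open>(fact m)\<^sup>2\<close> outweighs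
  \<open>2 ^ (m + 1)\<close>, so twice this number is less than \<open>2 ^ (m * m)\<close>.
\<close>

lemma colouring_without_monochromatic_bipartite:
  fixes V :: "'a set"
  assumes V: "finite V" "(card V)\<^sup>2 \<le> 2 ^ (m + 1)" and m: "3 \<le> m"
  shows "\<exists>S. \<forall>A B. A \<subseteq> V \<and> B \<subseteq> V \<and> A \<inter> B = {} \<and> card A = m \<and> card B = m \<longrightarrow>
    \<not> biclique A B \<subseteq> S \<and> biclique A B \<inter> S \<noteq> {}"
proof -
  define \<M> where "\<M> = {A. A \<subseteq> V \<and> card A = m}"
  define P where "P = {(A, B) \<in> \<M> \<times> \<M>. A \<inter> B = {}}"
  define \<F> where "\<F> = (\<lambda>(A, B). biclique A B) ` P"
  define c where "c = card V choose m"
  have card_M: "card \<M> = c" unfolding \<M>_def c_def using V(1) by (rule n_subsets)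
  have fin_M: "finite \<M>" unfolding \<M>_def using V(1) by simp
  have "card \<F> \<le> card P"
    unfolding \<F>_def by (rule card_image_le) (use fin_M in \<open>auto simp: P_def intro: finite_subset\<close>)
  also have "\<dots> \<le> card (\<M> \<times> \<M>)"
    using fin_M by (intro card_mono) (auto simp: P_def)
  also have "\<dots> = c\<^sup>2"
    by (simp add: card_cartesian_product card_M power2_eq_square)
  finally have F: "card \<F> \<le> c\<^sup>2" .
  have "(c * fact m)\<^sup>2 \<le> (card V ^ m)\<^sup>2"
    unfolding c_def by (intro power_mono binomial_fact_pow) simp
  also have "\<dots> = ((card V)\<^sup>2) ^ m" by (simp add: mult.commute flip: power_mult)
  also have "\<dots> \<le> (2 ^ (m + 1)) ^ m" using V(2) by (intro power_mono) auto
  also have "\<dots> = 2 ^ (m * m) * 2 ^ m" by (simp add: add.commute flip: power_mult power_add)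
  finally have "2 * c\<^sup>2 * (fact m)\<^sup>2 \<le> 2 ^ (m * m) * 2 ^ (m + 1)"
    by (simp add: power_mult_distrib)
  also have "\<dots> < 2 ^ (m * m) * (fact m)\<^sup>2"
    using power2_lt_fact_squared[OF m] by simp
  finally have "2 * c\<^sup>2 < 2 ^ (m * m)" by simp
  then have small: "2 * card \<F> < 2 ^ (m * m)" using F by linarith
  have "\<exists>S\<subseteq>Pow V. \<forall>F\<in>\<F>. \<not> F \<subseteq> S \<and> F \<inter> S \<noteq> {}"
  proof (rule two_colouring_exists[OF _ _ _ small])
    show "finite (Pow V)" using V(1) by simp
    show "\<F> \<subseteq> Pow (Pow V)" by (auto simp: \<F>_def P_def \<M>_def biclique_def)
    show "card F = m * m" if "F \<in> \<F>" for F
      using that by (auto simp: \<F>_def P_def \<M>_def card_biclique)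
  qed
  then obtain S where S: "\<forall>F\<in>\<F>. \<not> F \<subseteq> S \<and> F \<inter> S \<noteq> {}"
    by (elim exE conjE) (rule that)
  show ?thesis
  proof (intro exI[of _ S] allI impI)
    fix A B
    assume "A \<subseteq> V \<and> B \<subseteq> V \<and> A \<inter> B = {} \<and> card A = m \<and> card B = m"
    then have "(A, B) \<in> P" by (simp add: P_def \<M>_def)
    then have "biclique A B \<in> \<F>" unfolding \<F>_def by force
    then show "\<not> biclique A B \<subseteq> S \<and> biclique A B \<inter> S \<noteq> {}" by (rule S[THEN bspec])
  qed
qed

section \<open>The two-page drawing of a random colouring\<close>

theorem proposition1p2:
  fixes k :: nat
  assumes "k > 0"
  shows "\<exists>G. topological_graph G \<and> complete_topgraph G \<and> simple_topgraph G \<and>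
             card (verts G) = 2 ^ (k div 2) \<and>
             \<not> (\<exists>H D. topological_subgraph H G \<and> D \<in> C k k \<and> weakly_isomorphic H D)"
proof -
  define V where "V = (of_nat :: nat \<Rightarrow> complex) ` {..<2 ^ (k div 2)}"
  have V: "finite V" "V \<subseteq> \<real>" "card V = 2 ^ (k div 2)"
    by (auto simp: V_def card_image inj_on_def)
  have "\<exists>S. \<not> (\<exists>H D. topological_subgraph H (two_page V S) \<and> D \<in> C k k \<and> weakly_isomorphic H D)"
  proof (cases "k < 4")
    case True
    then have "k \<in> {1, 2, 3}" using assms by auto
    then have "card V < 2 * k" unfolding V(3) by auto
    then show ?thesis
      using verts_of_bipartite_copy[of "two_page V {}"] V(1)
      by (auto simp: two_page_def dest!: leD)
  next
    case False
    have "(card V)\<^sup>2 = 2 ^ (k div 2 * 2)" unfolding V(3) by (simp add: power_mult)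
    also have "\<dots> \<le> 2 ^ (k - 1 + 1)" using assms by (intro power_increasing) auto
    finally have "(card V)\<^sup>2 \<le> 2 ^ (k - 1 + 1)" .
    moreover have "3 \<le> k - 1" using False by simp
    ultimately obtain S where "\<forall>A B. A \<subseteq> V \<and> B \<subseteq> V \<and> A \<inter> B = {} \<and>
        card A = k - 1 \<and> card B = k - 1 \<longrightarrow> \<not> biclique A B \<subseteq> S \<and> biclique A B \<inter> S \<noteq> {}"
      using colouring_without_monochromatic_bipartite[OF V(1)] by metis
    then show ?thesis
      using bipartite_copy_monochromatic[OF V(2) assms, of _ S] by metis
  qed
  then obtain S where
    "\<not> (\<exists>H D. topological_subgraph H (two_page V S) \<and> D \<in> C k k \<and> weakly_isomorphic H D)" ..
  moreover have "card (verts (two_page V S)) = 2 ^ (k div 2)"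
    using V(3) by (simp add: two_page_def)
  ultimately show ?thesis
    using topological_graph_two_page[OF V(1,2)] simple_topgraph_two_page[OF V(2)]
      complete_topgraph_two_page by blast
qed

end
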